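(* Let $I=[-1,1]$, let $H,\widetilde H\in L^\infty(I)$ be nonnegative almost everywhere, and set $C_H=\int_I\sqrt{2H}\,\mathrm du$ and $C_{\widetilde H}=\int_I\sqrt{2\widetilde H}\,\mathrm du$. Then $$|C_{\widetilde H}-C_H|\le 2\sqrt{2\|\widetilde H-H\|_\infty}.$$ Suppose also $C_H,C_{\widetilde H}>0$ and $\sigma,\widetilde\sigma>0$. Define $\varepsilon=\sigma/C_H$, $F=\varepsilon^2H$, $\widetilde\varepsilon=\widetilde\sigma/C_{\widetilde H}$ and $\widetilde F=\widetilde\varepsilon^{\,2}\widetilde H$. Then the exact relative identity $$r_\varepsilon:=\frac{\widetilde\varepsilon}{\varepsilon}=\frac{\widetilde\sigma}{\sigma}\,\frac{C_H}{C_{\widetilde H}}$$ holds. Write $D=\|\widetilde H-H\|_\infty$, $\rho=2\sqrt{2D}/C_H$, and $\widetilde\sigma=(1+\delta)\sigma$ with $\delta>-1$. If $\rho<1$, then $$\frac{1+\delta}{1+\rho}\le r_\varepsilon\le\frac{1+\delta}{1-\rho},\qquad |r_\varepsilon-1|\le\frac{|\delta|+\rho}{1-\rho}.$$ For all such calibrated pairs, regardless of whether $\rho<1$, $$\|\widetilde F-F\|_\infty\le\varepsilon^2\left[r_\varepsilon^2D+|r_\varepsilon^2-1|\,\|H\|_\infty\right].$$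
   Context: $\|\cdot\|_\infty$ denotes the $L^\infty(I)$ norm (essential supremum) on $I=[-1,1]$ with Lebesgue measure. *)

theory Defs
  imports "HOL-Analysis.Analysis" "HOL-Probability.Essential_Supremum"
begin

text \<open>
  Elements of \<open>L\<^sup>\<infinity>\<close> are represented by functions rather than by classes modulo null sets.
  The norm is real-valued and therefore meaningful only on \<^term>\<open>Linf M\<close>
  (an infinite essential supremum is mapped to 0); the lemmas below show that it is the
  essential supremum there (for a nonzero measure) and that the space is closed under the operations used.
\<close>

definition Linf :: "'a measure \<Rightarrow> ('a \<Rightarrow> real) set" where
  "Linf M = {f \<in> borel_measurable M. esssup M (\<lambda>x. ereal \<bar>f x\<bar>) < \<infinity>}"

definition Linf_norm :: "'a measure \<Rightarrow> ('a \<Rightarrow> real) \<Rightarrow> real" where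
  "Linf_norm M f = real_of_ereal (esssup M (\<lambda>x. ereal \<bar>f x\<bar>))"

abbreviation leb_I :: "real measure" where
  "leb_I \<equiv> lebesgue_on {-1..1}"

definition C_int :: "(real \<Rightarrow> real) \<Rightarrow> real" where
  "C_int H = (LINT u|leb_I. sqrt (2 * H u))"

lemma Linf_iff_AE_bounded:
  "f \<in> Linf M \<longleftrightarrow> f \<in> borel_measurable M \<and> (\<exists>c. AE x in M. \<bar>f x\<bar> \<le> c)"
proof (intro iffI conjI; (elim conjE exE)?)
  assume f: "f \<in> Linf M"
  then show "f \<in> borel_measurable M" by (simp add: Linf_def)
  have "esssup M (\<lambda>x. ereal \<bar>f x\<bar>) < \<infinity>" using f by (simp add: Linf_def)
  then obtain c where c: "esssup M (\<lambda>x. ereal \<bar>f x\<bar>) < ereal c"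
    using less_PInf_Ex_of_nat by auto
  have "AE x in M. \<bar>f x\<bar> \<le> c"
    using esssup_AE[where M = M and f = "\<lambda>x. ereal \<bar>f x\<bar>"]
  proof eventually_elim
    case (elim x)
    then have "ereal \<bar>f x\<bar> \<le> ereal c" using less_imp_le[OF c] by (rule order_trans)
    then show ?case by simp
  qed
  then show "\<exists>c. AE x in M. \<bar>f x\<bar> \<le> c" ..
next
  fix c assume [measurable]: "f \<in> borel_measurable M" and c: "AE x in M. \<bar>f x\<bar> \<le> c"
  have "esssup M (\<lambda>x. ereal \<bar>f x\<bar>) \<le> ereal c"
    using c by (intro esssup_I) auto
  then have "esssup M (\<lambda>x. ereal \<bar>f x\<bar>) < \<infinity>"
    using le_less_trans by fastforce
  then show "f \<in> Linf M" by (simp add: Linf_def)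
qed

lemma Linf_diff: "f \<in> Linf M \<Longrightarrow> g \<in> Linf M \<Longrightarrow> (\<lambda>x. f x - g x) \<in> Linf M"
proof -
  assume f: "f \<in> Linf M" and g: "g \<in> Linf M"
  obtain a where a: "AE x in M. \<bar>f x\<bar> \<le> a" using f by (auto simp: Linf_iff_AE_bounded)
  obtain b where b: "AE x in M. \<bar>g x\<bar> \<le> b" using g by (auto simp: Linf_iff_AE_bounded)
  have "AE x in M. \<bar>f x - g x\<bar> \<le> a + b"
    using a b by eventually_elim linarith
  then show ?thesis using f g by (auto simp: Linf_iff_AE_bounded)
qed

lemma Linf_cmult: "f \<in> Linf M \<Longrightarrow> (\<lambda>x. c * f x) \<in> Linf M"
proof -
  assume f: "f \<in> Linf M"
  obtain a where a: "AE x in M. \<bar>f x\<bar> \<le> a" using f by (auto simp: Linf_iff_AE_bounded)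
  have "AE x in M. \<bar>c * f x\<bar> \<le> \<bar>c\<bar> * a"
    using a by eventually_elim (simp add: abs_mult mult_left_mono)
  then show ?thesis using f by (auto simp: Linf_iff_AE_bounded)
qed

lemma ereal_Linf_norm:
  assumes "f \<in> Linf M" and "emeasure M (space M) \<noteq> 0"
  shows "ereal (Linf_norm M f) = esssup M (\<lambda>x. ereal \<bar>f x\<bar>)"
proof -
  have f: "f \<in> borel_measurable M" and fin: "esssup M (\<lambda>x. ereal \<bar>f x\<bar>) < \<infinity>"
    using assms(1) by (auto simp: Linf_def)
  have "(0::ereal) = esssup M (\<lambda>x. 0)" using assms(2) by (simp add: esssup_const)
  also have "\<dots> \<le> esssup M (\<lambda>x. ereal \<bar>f x\<bar>)" by (rule esssup_mono) auto
  finally show ?thesis using fin unfolding Linf_norm_def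
    by (cases "esssup M (\<lambda>x. ereal \<bar>f x\<bar>)") auto
qed

lemma integrable_sqrt_Linf:
  assumes "H \<in> Linf leb_I"
  shows "integrable leb_I (\<lambda>u. sqrt (2 * H u))"
proof -
  obtain a where H: "H \<in> borel_measurable leb_I" and a: "AE u in leb_I. \<bar>H u\<bar> \<le> a"
    using assms by (auto simp: Linf_iff_AE_bounded)
  interpret finite_measure leb_I
    by (rule finite_measure_lebesgue_on) (simp add: lmeasurable_cbox[of "-1::real" 1, simplified])
  show ?thesis
  proof (rule integrable_const_bound)
    show "AE u in leb_I. norm (sqrt (2 * H u)) \<le> sqrt (2 * a)"
      using a
    proof eventually_elim
      case (elim u)
      have "norm (sqrt (2 * H u)) = sqrt (2 * \<bar>H u\<bar>)"
        by (cases "0 \<le> H u") (simp_all add: abs_if mult_less_0_iff flip: real_sqrt_minus)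
      also have "\<dots> \<le> sqrt (2 * a)" using elim by simp
      finally show ?case .
    qed
    show "(\<lambda>u. sqrt (2 * H u)) \<in> borel_measurable leb_I" using H by measurable
  qed
qed

end

theory Submission
  imports Defs
begin

text \<open>
  The estimate for \<^const>\<open>C_int\<close> rests on the \<open>1/2\<close>-Hoelder continuity of the square root,
  \<open>\<bar>\<surd>x - \<surd>y\<bar> \<le> \<surd>\<bar>x - y\<bar>\<close> (\<open>abs_sqrt_diff_le_sqrt_abs_diff\<close>), which is uniform down to \<open>0\<close>, where the
  Lipschitz estimate degenerates. It bounds the difference of the two integrands almost everywhere by the constant
  \<open>\<surd>(2D)\<close>, and the factor \<open>2\<close> is the length of the interval (\<open>C_int_diff_le\<close>).

  With \<open>C, C'\<close> the two integrals and \<open>\<rho> = 2\<surd>(2D) / C\<close>, this estimate reads \<open>\<bar>C' - C\<bar> \<le> \<rho>C\<close>. The ratio of the calibrated scales is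
  \<open>r = (1 + \<delta>) C / C'\<close>, so for \<open>\<rho> < 1\<close> the bounds on \<open>r\<close> are plain real arithmetic
  (\<open>scaled_quotient_bounds\<close>). The last bound is the triangle inequality applied to
  \<open>\<epsilon>'\<^sup>2H' - \<epsilon>\<^sup>2H = \<epsilon>\<^sup>2(r\<^sup>2(H' - H) + (r\<^sup>2 - 1)H)\<close>, which separates the change of the function from the change
  of the scale (\<open>Linf_norm_rescaled_diff_le\<close>).
\<close>

text \<open>
  This is subadditivity of the square root: the larger argument is the smaller one plus the gap.
\<close>
lemma abs_sqrt_diff_le_sqrt_abs_diff:
  fixes x y :: real
  assumes "0 \<le> x" "0 \<le> y"
  shows "\<bar>sqrt x - sqrt y\<bar> \<le> sqrt \<bar>x - y\<bar>"
proof -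
  have le: "sqrt b - sqrt a \<le> sqrt \<bar>b - a\<bar>" if "0 \<le> a" "a \<le> b" for a b :: real
    using that sqrt_add_le_add_sqrt[of a "b - a"] by simp
  show ?thesis
  proof (cases "x \<le> y")
    case True
    then show ?thesis using le[of x y] assms by (simp add: abs_minus_commute)
  next
    case False
    then show ?thesis using le[of y x] assms by simp
  qed
qed

lemma AE_abs_le_Linf_norm:
  assumes "f \<in> Linf M" "emeasure M (space M) \<noteq> 0"
  shows "AE x in M. \<bar>f x\<bar> \<le> Linf_norm M f"
  using esssup_AE[where M = M and f = "\<lambda>x. ereal \<bar>f x\<bar>"]
  by (simp flip: ereal_Linf_norm[OF assms])

lemma Linf_norm_le:
  assumes f: "f \<in> borel_measurable M" and nz: "emeasure M (space M) \<noteq> 0"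
    and bound: "AE x in M. \<bar>f x\<bar> \<le> c"
  shows "Linf_norm M f \<le> c"
proof -
  have "f \<in> Linf M"
    using f bound by (auto simp: Linf_iff_AE_bounded)
  then have "ereal (Linf_norm M f) = esssup M (\<lambda>x. ereal \<bar>f x\<bar>)"
    using nz by (rule ereal_Linf_norm)
  also have "\<dots> \<le> ereal c"
    using f bound by (intro esssup_I) auto
  finally show ?thesis by simp
qed

lemma Linf_norm_linear_combination_le:
  assumes f: "f \<in> Linf M" and g: "g \<in> Linf M" and nz: "emeasure M (space M) \<noteq> 0"
  shows "Linf_norm M (\<lambda>x. a * f x + b * g x) \<le> \<bar>a\<bar> * Linf_norm M f + \<bar>b\<bar> * Linf_norm M g"
proof (rule Linf_norm_le[OF _ nz])
  show "(\<lambda>x. a * f x + b * g x) \<in> borel_measurable M"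
    using f g by (auto simp: Linf_def)
  show "AE x in M. \<bar>a * f x + b * g x\<bar> \<le> \<bar>a\<bar> * Linf_norm M f + \<bar>b\<bar> * Linf_norm M g"
    using AE_abs_le_Linf_norm[OF f nz] AE_abs_le_Linf_norm[OF g nz]
  proof eventually_elim
    case (elim x)
    have "\<bar>a * f x + b * g x\<bar> \<le> \<bar>a\<bar> * \<bar>f x\<bar> + \<bar>b\<bar> * \<bar>g x\<bar>"
      by (metis abs_mult abs_triangle_ineq)
    also have "\<dots> \<le> \<bar>a\<bar> * Linf_norm M f + \<bar>b\<bar> * Linf_norm M g"
      using elim by (intro add_mono mult_left_mono) auto
    finally show ?case .
  qed
qed

lemma emeasure_leb_I: "emeasure leb_I {-1..1} = 2"
  by (simp add: emeasure_restrict_space)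

lemma C_int_diff_le:
  assumes H: "H \<in> Linf leb_I" and H': "H' \<in> Linf leb_I"
    and pos: "AE u in leb_I. 0 \<le> H u" and pos': "AE u in leb_I. 0 \<le> H' u"
  shows "\<bar>C_int H' - C_int H\<bar> \<le> 2 * sqrt (2 * Linf_norm leb_I (\<lambda>u. H' u - H u))"
proof -
  let ?D = "Linf_norm leb_I (\<lambda>u. H' u - H u)"
  let ?g = "\<lambda>u. sqrt (2 * H' u) - sqrt (2 * H u)"
  interpret finite_measure leb_I
    by (rule finite_measureI) (simp add: emeasure_leb_I)
  have int: "integrable leb_I ?g"
    using H H' by (intro Bochner_Integration.integrable_diff integrable_sqrt_Linf)
  have "AE u in leb_I. \<bar>H' u - H u\<bar> \<le> ?D"
    using H H' by (intro AE_abs_le_Linf_norm Linf_diff) (simp_all add: emeasure_leb_I)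
  with pos pos' have bound: "AE u in leb_I. \<bar>?g u\<bar> \<le> sqrt (2 * ?D)"
  proof eventually_elim
    case (elim u)
    then have "\<bar>?g u\<bar> \<le> sqrt \<bar>2 * H' u - 2 * H u\<bar>"
      by (intro abs_sqrt_diff_le_sqrt_abs_diff) auto
    also have "\<dots> \<le> sqrt (2 * ?D)" using elim by simp
    finally show ?case .
  qed
  have "\<bar>C_int H' - C_int H\<bar> = \<bar>LINT u|leb_I. ?g u\<bar>"
    using H H' by (simp add: C_int_def Bochner_Integration.integral_diff integrable_sqrt_Linf)
  also have "\<dots> \<le> (LINT u|leb_I. \<bar>?g u\<bar>)"
    by (rule integral_abs_bound)
  also have "\<dots> \<le> (LINT u|leb_I. sqrt (2 * ?D))"
    using int bound by (intro integral_mono_AE) auto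
  also have "\<dots> = 2 * sqrt (2 * ?D)"
    by (simp add: measure_def emeasure_leb_I)
  finally show ?thesis .
qed

text \<open>
  All three bounds come from the single enclosure \<open>(1 - \<rho>) C \<le> C' \<le> (1 + \<rho>) C\<close>. For the last one
  the numerator of \<open>r - 1\<close> splits as \<open>\<delta>C + (C - C')\<close>, of modulus at most \<open>(\<bar>\<delta>\<bar> + \<rho>) C\<close>,
  while the denominator \<open>C'\<close> is at least \<open>(1 - \<rho>) C\<close>.
\<close>
lemma scaled_quotient_bounds:
  fixes C C' \<delta> \<rho> :: real
  assumes C: "0 < C" and close: "\<bar>C' - C\<bar> \<le> \<rho> * C" and \<rho>: "\<rho> < 1" and \<delta>: "-1 < \<delta>"
  defines "r \<equiv> (1 + \<delta>) * (C / C')"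
  shows "(1 + \<delta>) / (1 + \<rho>) \<le> r" and "r \<le> (1 + \<delta>) / (1 - \<rho>)"
    and "\<bar>r - 1\<bar> \<le> (\<bar>\<delta>\<bar> + \<rho>) / (1 - \<rho>)"
proof -
  have \<rho>0: "0 \<le> \<rho>"
    using C close abs_ge_zero[of "C' - C"] by (meson order_trans zero_le_mult_iff not_le)
  have lo: "(1 - \<rho>) * C \<le> C'" and hi: "C' \<le> (1 + \<rho>) * C"
    using close by (auto simp: algebra_simps abs_le_iff)
  have "0 < (1 - \<rho>) * C" using C \<rho> by simp
  then have C': "0 < C'" using lo by linarith
  have "1 / (1 + \<rho>) \<le> C / C'"
    using hi C' \<rho>0 by (simp add: field_simps)
  then show "(1 + \<delta>) / (1 + \<rho>) \<le> r"
    using \<delta> mult_left_mono[of "1 / (1 + \<rho>)" "C / C'" "1 + \<delta>"] by (simp add: r_def)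
  have quot: "C / C' \<le> 1 / (1 - \<rho>)"
    using lo C' \<rho> by (simp add: field_simps)
  then show "r \<le> (1 + \<delta>) / (1 - \<rho>)"
    using \<delta> mult_left_mono[of "C / C'" "1 / (1 - \<rho>)" "1 + \<delta>"] by (simp add: r_def)
  have "\<bar>r - 1\<bar> = \<bar>\<delta> * C + (C - C')\<bar> / C'"
    using C' by (simp add: r_def field_simps abs_divide[symmetric])
  also have "\<dots> \<le> (\<bar>\<delta>\<bar> * C + \<rho> * C) / C'"
  proof (rule divide_right_mono)
    have "\<bar>\<delta> * C\<bar> = \<bar>\<delta>\<bar> * C" using C by (simp add: abs_mult)
    then show "\<bar>\<delta> * C + (C - C')\<bar> \<le> \<bar>\<delta>\<bar> * C + \<rho> * C"
      using close by linarith
  qed (use C' in simp)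
  also have "\<dots> = (\<bar>\<delta>\<bar> + \<rho>) * (C / C')"
    by (simp add: algebra_simps add_divide_distrib)
  also have "\<dots> \<le> (\<bar>\<delta>\<bar> + \<rho>) * (1 / (1 - \<rho>))"
    using quot \<rho>0 by (intro mult_left_mono) auto
  finally show "\<bar>r - 1\<bar> \<le> (\<bar>\<delta>\<bar> + \<rho>) / (1 - \<rho>)" by simp
qed

text \<open>
  Measuring the new scale relative to the old one turns the difference of the rescaled functions into a
  combination of \<open>g - f\<close> and \<open>f\<close> alone, so that the norm of \<open>g\<close> does not enter the bound.
\<close>
lemma Linf_norm_rescaled_diff_le:
  fixes \<epsilon> \<epsilon>' :: real
  assumes f: "f \<in> Linf M" and g: "g \<in> Linf M" and nz: "emeasure M (space M) \<noteq> 0"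
    and \<epsilon>: "\<epsilon> \<noteq> 0"
  shows "Linf_norm M (\<lambda>x. \<epsilon>'\<^sup>2 * g x - \<epsilon>\<^sup>2 * f x)
    \<le> \<epsilon>\<^sup>2 * ((\<epsilon>' / \<epsilon>)\<^sup>2 * Linf_norm M (\<lambda>x. g x - f x) + \<bar>(\<epsilon>' / \<epsilon>)\<^sup>2 - 1\<bar> * Linf_norm M f)"
proof -
  let ?r = "\<epsilon>' / \<epsilon>"
  have scale: "\<epsilon>'\<^sup>2 = \<epsilon>\<^sup>2 * ?r\<^sup>2"
    using \<epsilon> by (simp add: power_divide)
  have decomp: "(\<lambda>x. \<epsilon>'\<^sup>2 * g x - \<epsilon>\<^sup>2 * f x)
      = (\<lambda>x. (\<epsilon>\<^sup>2 * ?r\<^sup>2) * (g x - f x) + (\<epsilon>\<^sup>2 * (?r\<^sup>2 - 1)) * f x)"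
    unfolding scale by (simp add: algebra_simps)
  have "Linf_norm M (\<lambda>x. \<epsilon>'\<^sup>2 * g x - \<epsilon>\<^sup>2 * f x)
      \<le> \<bar>\<epsilon>\<^sup>2 * ?r\<^sup>2\<bar> * Linf_norm M (\<lambda>x. g x - f x)
      + \<bar>\<epsilon>\<^sup>2 * (?r\<^sup>2 - 1)\<bar> * Linf_norm M f"
    unfolding decomp by (rule Linf_norm_linear_combination_le[OF Linf_diff[OF g f] f nz])
  also have "\<dots> = \<epsilon>\<^sup>2 * (?r\<^sup>2 * Linf_norm M (\<lambda>x. g x - f x) + \<bar>?r\<^sup>2 - 1\<bar> * Linf_norm M f)"
    by (simp only: abs_mult abs_power2 distrib_left mult.assoc)
  finally show ?thesis .
qed

theorem theorem1:
  fixes H H' :: "real \<Rightarrow> real"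
  assumes "H \<in> Linf leb_I" and "H' \<in> Linf leb_I"
    and "AE u in leb_I. 0 \<le> H u" and "AE u in leb_I. 0 \<le> H' u"
  shows "let D = Linf_norm leb_I (\<lambda>u. H' u - H u) in
    \<bar>C_int H' - C_int H\<bar> \<le> 2 * sqrt (2 * D) \<and>
    (\<forall>\<sigma> \<sigma>'. C_int H > 0 \<and> C_int H' > 0 \<and> \<sigma> > 0 \<and> \<sigma>' > 0 \<longrightarrow>
      (let \<epsilon> = \<sigma> / C_int H; F = (\<lambda>u. \<epsilon>\<^sup>2 * H u);
           \<epsilon>' = \<sigma>' / C_int H'; F' = (\<lambda>u. \<epsilon>'\<^sup>2 * H' u);
           r = \<epsilon>' / \<epsilon>; \<rho> = 2 * sqrt (2 * D) / C_int H
       in r = (\<sigma>' / \<sigma>) * (C_int H / C_int H') \<and>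
          (\<forall>\<delta>. \<delta> > -1 \<and> \<sigma>' = (1 + \<delta>) * \<sigma> \<and> \<rho> < 1 \<longrightarrow>
             (1 + \<delta>) / (1 + \<rho>) \<le> r \<and> r \<le> (1 + \<delta>) / (1 - \<rho>) \<and>
             \<bar>r - 1\<bar> \<le> (\<bar>\<delta>\<bar> + \<rho>) / (1 - \<rho>)) \<and>
          Linf_norm leb_I (\<lambda>u. F' u - F u)
            \<le> \<epsilon>\<^sup>2 * (r\<^sup>2 * D + \<bar>r\<^sup>2 - 1\<bar> * Linf_norm leb_I H)))"
proof -
  define D where "D = Linf_norm leb_I (\<lambda>u. H' u - H u)"
  have diff: "\<bar>C_int H' - C_int H\<bar> \<le> 2 * sqrt (2 * D)"
    unfolding D_def using assms by (rule C_int_diff_le)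
  have ratio: "(\<sigma>' / C_int H') / (\<sigma> / C_int H) = (\<sigma>' / \<sigma>) * (C_int H / C_int H')" for \<sigma> \<sigma>'
    by simp
  have bounds: "(1 + \<delta>) / (1 + \<rho>) \<le> r \<and> r \<le> (1 + \<delta>) / (1 - \<rho>) \<and> \<bar>r - 1\<bar> \<le> (\<bar>\<delta>\<bar> + \<rho>) / (1 - \<rho>)"
    if "C_int H > 0" "\<sigma> > 0" "\<delta> > -1" "\<sigma>' = (1 + \<delta>) * \<sigma>" "\<rho> < 1"
      "\<rho> = 2 * sqrt (2 * D) / C_int H" "r = (\<sigma>' / C_int H') / (\<sigma> / C_int H)" for \<sigma> \<sigma>' \<delta> \<rho> r
  proof -
    have "r = (1 + \<delta>) * (C_int H / C_int H')"
      using that ratio[of \<sigma>' \<sigma>] by simp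
    moreover have "\<bar>C_int H' - C_int H\<bar> \<le> \<rho> * C_int H"
      using diff that by simp
    ultimately show ?thesis
      using scaled_quotient_bounds[of "C_int H" "C_int H'" \<rho> \<delta>] that by simp
  qed
  have rescaled: "Linf_norm leb_I (\<lambda>u. \<epsilon>'\<^sup>2 * H' u - \<epsilon>\<^sup>2 * H u)
      \<le> \<epsilon>\<^sup>2 * ((\<epsilon>' / \<epsilon>)\<^sup>2 * D + \<bar>(\<epsilon>' / \<epsilon>)\<^sup>2 - 1\<bar> * Linf_norm leb_I H)" if "\<epsilon> \<noteq> 0" for \<epsilon> \<epsilon>'
    unfolding D_def using assms(1,2) that
    by (intro Linf_norm_rescaled_diff_le) (simp_all add: emeasure_leb_I)
  show ?thesis
    unfolding Let_def D_def[symmetric]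
  proof (intro conjI[OF diff] allI impI; elim conjE)
    fix \<sigma> \<sigma>' :: real
    assume C: "0 < C_int H" "0 < C_int H'" and \<sigma>: "0 < \<sigma>" "0 < \<sigma>'"
    then have "\<sigma> / C_int H \<noteq> 0" by simp
    note scaled = rescaled[OF this, of "\<sigma>' / C_int H'"]
    show "(\<sigma>' / C_int H') / (\<sigma> / C_int H) = (\<sigma>' / \<sigma>) * (C_int H / C_int H') \<and>
      (\<forall>\<delta>. \<delta> > -1 \<and> \<sigma>' = (1 + \<delta>) * \<sigma> \<and> 2 * sqrt (2 * D) / C_int H < 1 \<longrightarrow>
        (1 + \<delta>) / (1 + 2 * sqrt (2 * D) / C_int H) \<le> (\<sigma>' / C_int H') / (\<sigma> / C_int H) \<and>
        (\<sigma>' / C_int H') / (\<sigma> / C_int H) \<le> (1 + \<delta>) / (1 - 2 * sqrt (2 * D) / C_int H) \<and>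
        \<bar>(\<sigma>' / C_int H') / (\<sigma> / C_int H) - 1\<bar>
          \<le> (\<bar>\<delta>\<bar> + 2 * sqrt (2 * D) / C_int H) / (1 - 2 * sqrt (2 * D) / C_int H)) \<and>
      Linf_norm leb_I (\<lambda>u. (\<sigma>' / C_int H')\<^sup>2 * H' u - (\<sigma> / C_int H)\<^sup>2 * H u)
        \<le> (\<sigma> / C_int H)\<^sup>2 * (((\<sigma>' / C_int H') / (\<sigma> / C_int H))\<^sup>2 * D
          + \<bar>((\<sigma>' / C_int H') / (\<sigma> / C_int H))\<^sup>2 - 1\<bar> * Linf_norm leb_I H)"
    proof (intro conjI[OF ratio] conjI[OF _ scaled] allI impI; elim conjE)
      fix \<delta> :: real
      assume "- 1 < \<delta>" "\<sigma>' = (1 + \<delta>) * \<sigma>" "2 * sqrt (2 * D) / C_int H < 1"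
      from bounds[OF C(1) \<sigma>(1) this refl refl]
      show "(1 + \<delta>) / (1 + 2 * sqrt (2 * D) / C_int H) \<le> (\<sigma>' / C_int H') / (\<sigma> / C_int H) \<and>
        (\<sigma>' / C_int H') / (\<sigma> / C_int H) \<le> (1 + \<delta>) / (1 - 2 * sqrt (2 * D) / C_int H) \<and>
        \<bar>(\<sigma>' / C_int H') / (\<sigma> / C_int H) - 1\<bar>
          \<le> (\<bar>\<delta>\<bar> + 2 * sqrt (2 * D) / C_int H) / (1 - 2 * sqrt (2 * D) / C_int H)" .
    qed
  qed
qed

end
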